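(* Let $T$ be a rooted tree with $n>1$ vertices. Then $$\rho_L(T)\ge\frac{1}{n-1}\max_{1\le i\le n}\Big(LI-L_i+\sqrt{(LI-L_i)^2+(n-1)L_i^2}\Big).$$
   Context: A rooted tree is a finite tree with a distinguished vertex (the root). The level $l(v)$ of a vertex $v$ is its distance from the root. For a rooted tree $T$ with vertices $v_1,\dots,v_n$, the level matrix $L(T)=(l_{ij})$ is the $n\times n$ real symmetric matrix with $l_{ij}=|l(v_i)-l(v_j)|$. The level spectral radius $\rho_L(T)$ is the largest absolute value of an eigenvalue of $L(T)$. Set $L_i=L_i(T)=\sum_{j=1}^n l_{ij}$ (the $i$-th row sum). The level index $LI=LI(T)$ is half the sum of all entries of $L(T)$. *)

theory Defs
  imports "Graph_Theory.Graph_Theory" "Jordan_Normal_Form.Spectral_Radius"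
begin

text \<open>
  An undirected finite simple graph is a \<^locale>\<open>pair_graph\<close>: finite, loop-free, with an edge
  \<open>uv\<close> given by the two arcs \<open>(u, v)\<close> and \<open>(v, u)\<close>. These two arcs already
  form a \<open>cycle\<close> of length 2 in the sense of the library, whose predicates
  \<open>forest\<close> and \<open>tree\<close> are therefore false for every symmetric graph with an edge.
  The cycles of the undirected graph are those of length at least 3.
\<close>

locale rooted_tree = pair_graph T for T :: "'a pair_pre_digraph" +
  fixes r :: 'a
  assumes connected_tree: "Digraph_Component.connected (with_proj T)"
    and acyclic_tree: "\<not> (\<exists>p. pre_digraph.cycle (with_proj T) p \<and> length p \<ge> 3)"
    and root_in_verts: "r \<in> pverts T"

definition level :: "'a pair_pre_digraph \<Rightarrow> 'a \<Rightarrow> 'a \<Rightarrow> real" where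
  "level T r v = real_of_ereal (wf_digraph.\<mu> (with_proj T) (\<lambda>_. 1) r v)"

lemma (in rooted_tree) level_eq_Least:
  assumes "v \<in> pverts T"
  shows "level T r v =
    real (LEAST k. \<exists>p. pre_digraph.awalk (with_proj T) r p v \<and> length p = k)"
proof -
  let ?P = "\<lambda>k. \<exists>p. pre_digraph.awalk (with_proj T) r p v \<and> length p = k"
  let ?k = "LEAST k. ?P k"
  have "strongly_connected (with_proj T)"
    using connected_tree pair_sym_arcs symmetric_connected_imp_strongly_connected by blast
  then have "r \<rightarrow>\<^sup>*\<^bsub>with_proj T\<^esub> v"
    using assms root_in_verts by (auto simp: strongly_connected_def)
  then obtain q where "pre_digraph.awalk (with_proj T) r q v"
    using reachable_awalk by auto
  then have ex: "?P (length q)" by blast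
  have cost: "awalk_cost (\<lambda>_. 1) p = real (length p)" for p
    by (induct p) auto
  obtain p where p: "pre_digraph.awalk (with_proj T) r p v" "length p = ?k"
    using LeastI[of ?P, OF ex] by blast
  have "\<mu> (\<lambda>_. 1) r v = ereal (real ?k)"
    unfolding \<mu>_def cost
  proof (rule antisym)
    show "(INF p\<in>{p. awalk r p v}. ereal (real (length p))) \<le> ereal (real ?k)"
      using p by (intro INF_lower2[of p]) auto
    show "ereal (real ?k) \<le> (INF p\<in>{p. awalk r p v}. ereal (real (length p)))"
      by (rule INF_greatest) (auto intro!: Least_le)
  qed
  then show ?thesis by (simp add: level_def)
qed

text \<open>In what follows the list \<open>vs\<close> is an enumeration of the vertices, indexed from 0.\<close>

definition level_matrix :: "'a pair_pre_digraph \<Rightarrow> 'a \<Rightarrow> 'a list \<Rightarrow> real mat" where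
  "level_matrix T r vs = mat (length vs) (length vs)
     (\<lambda>(i, j). \<bar>level T r (vs ! i) - level T r (vs ! j)\<bar>)"

definition level_spectral_radius :: "'a pair_pre_digraph \<Rightarrow> 'a \<Rightarrow> 'a list \<Rightarrow> real" where
  "level_spectral_radius T r vs =
     spectral_radius (map_mat complex_of_real (level_matrix T r vs))"

definition level_row_sum :: "'a pair_pre_digraph \<Rightarrow> 'a \<Rightarrow> 'a list \<Rightarrow> nat \<Rightarrow> real" where
  "level_row_sum T r vs i = (\<Sum>j<length vs. level_matrix T r vs $$ (i, j))"

definition level_index :: "'a pair_pre_digraph \<Rightarrow> 'a \<Rightarrow> 'a list \<Rightarrow> real" where
  "level_index T r vs =
     (\<Sum>i<length vs. \<Sum>j<length vs. level_matrix T r vs $$ (i, j)) / 2"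

end

theory Submission
  imports Defs "HOL-Analysis.Convex"
begin

unbundle no inner_syntax

text \<open>
  The bound is a Rayleigh quotient estimate for the real symmetric level matrix \<open>L\<close>. For a fixed
  vertex \<open>i\<close>, consider vectors that are constant on the complement of \<open>{i}\<close>. Since \<open>L\<close> has a zero
  diagonal, its quadratic form on the vector with entry \<open>a\<close> at \<open>i\<close> and \<open>b\<close> elsewhere is
  \<open>2 a b L_i + 2 b^2 (LI - L_i)\<close>, while the squared norm is \<open>a^2 + (n - 1) b^2\<close>. The maximum of the
  quotient is the larger root \<open>\<lambda>\<close> of \<open>(n - 1) \<lambda>^2 = 2 (LI - L_i) \<lambda> + L_i^2\<close>, which is the claimed
  bound; for \<open>\<lambda> \<noteq> 0\<close> it is attained at \<open>a = L_i\<close>, \<open>b = \<lambda>\<close> (lemmas \<open>quadratic_form_two_valued\<close> and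
  \<open>spectral_radius_ge_larger_root\<close>).

  That Rayleigh quotients do not exceed the spectral radius is derived without diagonalising the
  matrix \<open>A\<close>. By the Cauchy-Schwarz inequality, the numbers \<open>x \<bullet> A^k x\<close> satisfy
  \<open>(x \<bullet> A^k x)^2 \<le> (x \<bullet> x) (x \<bullet> A^(2k) x)\<close>, so along \<open>k = 2^m\<close> they grow at least like the \<open>k\<close>-th
  power of the Rayleigh quotient. The Jordan normal form bounds their growth by \<open>t^k\<close> for every \<open>t\<close>
  above the spectral radius. Comparing both rates gives \<open>rayleigh_le_spectral_radius\<close>.
\<close>

section \<open>Growth of matrix powers\<close>

lemma pow_smult_mat:
  fixes A :: "'a :: comm_semiring_1 mat"
  assumes A: "A \<in> carrier_mat n n"
  shows "(c \<cdot>\<^sub>m A) ^\<^sub>m k = c ^ k \<cdot>\<^sub>m (A ^\<^sub>m k)"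
proof (induction k)
  case 0
  show ?case using A by (intro eq_matI) auto
next
  case (Suc k)
  have Ak: "A ^\<^sub>m k \<in> carrier_mat n n" using A by simp
  have "(c \<cdot>\<^sub>m A) ^\<^sub>m Suc k = (c ^ k \<cdot>\<^sub>m A ^\<^sub>m k) * (c \<cdot>\<^sub>m A)"
    by (simp add: Suc)
  also have "\<dots> = c \<cdot>\<^sub>m (c ^ k \<cdot>\<^sub>m (A ^\<^sub>m k * A))"
    using Ak A by (simp add: mult_smult_assoc_mat[of _ n n _ n] mult_smult_distrib[of _ n n _ n])
  also have "\<dots> = c ^ Suc k \<cdot>\<^sub>m A ^\<^sub>m Suc k"
    using A Ak by (intro eq_matI) (auto simp: algebra_simps)
  finally show ?case .
qed

lemma spectral_radius_nonneg:
  assumes "A \<in> carrier_mat n n" "n > 0"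
  shows "spectral_radius A \<ge> 0"
  using spectral_radius_mem_max(1)[OF assms] by auto

text \<open>Dividing by \<open>t\<close> divides every eigenvalue by \<open>t\<close>.\<close>

lemma spectral_radius_smult_less_1:
  fixes A :: "complex mat"
  assumes A: "A \<in> carrier_mat n n" and n: "n > 0" and t: "spectral_radius A < t"
  shows "spectral_radius (complex_of_real (1 / t) \<cdot>\<^sub>m A) < 1"
proof -
  let ?c = "complex_of_real (1 / t)"
  let ?B = "?c \<cdot>\<^sub>m A"
  have tpos: "t > 0" using spectral_radius_nonneg[OF A n] t by linarith
  have B: "?B \<in> carrier_mat n n" using A by simp
  obtain e where e: "eigenvalue ?B e" and sr: "spectral_radius ?B = cmod e"
    using spectral_radius_mem_max(1)[OF B n] by (auto simp: spectrum_def)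
  obtain v where v: "v \<in> carrier_vec n" "v \<noteq> 0\<^sub>v n" and ev: "?B *\<^sub>v v = e \<cdot>\<^sub>v v"
    using e A unfolding eigenvalue_def eigenvector_def by auto
  have "A *\<^sub>v v = (complex_of_real t * e) \<cdot>\<^sub>v v"
  proof (rule eq_vecI)
    fix i assume "i < dim_vec ((complex_of_real t * e) \<cdot>\<^sub>v v)"
    then have i: "i < n" using v by simp
    have "(?B *\<^sub>v v) $ i = (e \<cdot>\<^sub>v v) $ i" using ev by simp
    then have "?c * (A *\<^sub>v v) $ i = e * v $ i"
      using i A v by simp
    then show "(A *\<^sub>v v) $ i = ((complex_of_real t * e) \<cdot>\<^sub>v v) $ i"
      using i v tpos by (simp add: field_simps)
  qed (use A v in auto)
  then have "eigenvalue A (complex_of_real t * e)"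
    using v A unfolding eigenvalue_def eigenvector_def by auto
  then have "cmod (complex_of_real t * e) \<le> spectral_radius A"
    by (intro spectral_radius_mem_max(2)[OF A n] imageI) (simp add: spectrum_def)
  then have "t * cmod e \<le> spectral_radius A" using tpos by (simp add: norm_mult)
  then have "t * cmod e < t * 1" using t by linarith
  then show ?thesis using mult_less_cancel_left_pos[OF tpos] unfolding sr by blast
qed

text \<open>
  Powers of a matrix of spectral radius at most 1 may grow polynomially because of nontrivial Jordan
  blocks at eigenvalues of modulus 1. With \<open>t\<close> strictly above the spectral radius of \<open>A\<close>, the
  eigenvalues of \<open>A / t\<close> lie inside the open unit disc, so its powers stay bounded.
\<close>

lemma pow_entries_bound:
  fixes A :: "real mat"
  assumes A: "A \<in> carrier_mat n n" and n: "n > 0"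
    and t: "spectral_radius (map_mat complex_of_real A) < t"
  obtains c where "\<And>k i j. i < n \<Longrightarrow> j < n \<Longrightarrow> \<bar>(A ^\<^sub>m k) $$ (i, j)\<bar> \<le> c * t ^ k"
proof -
  let ?C = "map_mat complex_of_real A"
  let ?B = "complex_of_real (1 / t) \<cdot>\<^sub>m ?C"
  have C: "?C \<in> carrier_mat n n" using A by simp
  have tpos: "t > 0" using spectral_radius_nonneg[OF C n] t by linarith
  have B: "?B \<in> carrier_mat n n" using C by simp
  obtain c where c: "\<And>k. norm_bound (?B ^\<^sub>m k) c"
    using spectral_radius_jnf_norm_bound_less_1_upper_triangular[OF B
        spectral_radius_smult_less_1[OF C n t]] by auto
  have pow: "?B ^\<^sub>m k = complex_of_real (1 / t) ^ k \<cdot>\<^sub>m map_mat complex_of_real (A ^\<^sub>m k)" for k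
    by (simp only: pow_smult_mat[OF C] of_real_hom.mat_hom_pow[OF A])
  have "\<bar>(A ^\<^sub>m k) $$ (i, j)\<bar> \<le> c * t ^ k" if ij: "i < n" "j < n" for k i j
  proof -
    have "cmod ((?B ^\<^sub>m k) $$ (i, j)) \<le> c"
      using c[of k] ij carrier_matD[OF pow_carrier_mat[OF B, of k]]
      unfolding norm_bound_def by metis
    then have "\<bar>(A ^\<^sub>m k) $$ (i, j)\<bar> / t ^ k \<le> c"
      unfolding pow using ij A tpos pow_carrier_mat[OF A, of k]
      by (simp add: norm_mult norm_power norm_divide power_divide)
    then show ?thesis using tpos by (simp add: field_simps)
  qed
  then show thesis using that by blast
qed

lemma quadratic_form_pow_bound:
  fixes A :: "real mat"
  assumes A: "A \<in> carrier_mat n n" and n: "n > 0" and x: "x \<in> carrier_vec n"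
    and t: "spectral_radius (map_mat complex_of_real A) < t"
  obtains c where "\<And>k. x \<bullet> (A ^\<^sub>m k *\<^sub>v x) \<le> c * t ^ k"
proof -
  obtain c where c: "\<And>k i j. i < n \<Longrightarrow> j < n \<Longrightarrow> \<bar>(A ^\<^sub>m k) $$ (i, j)\<bar> \<le> c * t ^ k"
    using pow_entries_bound[OF A n t] by blast
  define s where "s = (\<Sum>i<n. \<Sum>j<n. \<bar>x $ i\<bar> * \<bar>x $ j\<bar>)"
  have "x \<bullet> (A ^\<^sub>m k *\<^sub>v x) \<le> (s * c) * t ^ k" for k
  proof -
    have Ak: "A ^\<^sub>m k \<in> carrier_mat n n" using A by simp
    have "x \<bullet> (A ^\<^sub>m k *\<^sub>v x) = (\<Sum>i<n. \<Sum>j<n. x $ i * ((A ^\<^sub>m k) $$ (i, j) * x $ j))"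
      using carrier_matD[OF Ak] carrier_matD[OF A] x
      by (simp add: scalar_prod_def atLeast0LessThan sum_distrib_left)
    also have "\<dots> \<le> (\<Sum>i<n. \<Sum>j<n. (\<bar>x $ i\<bar> * \<bar>x $ j\<bar>) * (c * t ^ k))"
    proof (intro sum_mono)
      fix i j assume ij: "i \<in> {..<n}" "j \<in> {..<n}"
      have "x $ i * ((A ^\<^sub>m k) $$ (i, j) * x $ j) \<le> \<bar>x $ i * ((A ^\<^sub>m k) $$ (i, j) * x $ j)\<bar>"
        by simp
      also have "\<dots> = (\<bar>x $ i\<bar> * \<bar>x $ j\<bar>) * \<bar>(A ^\<^sub>m k) $$ (i, j)\<bar>"
        by (simp add: abs_mult)
      also have "\<dots> \<le> (\<bar>x $ i\<bar> * \<bar>x $ j\<bar>) * (c * t ^ k)"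
        using c[of i j k] ij by (intro mult_left_mono) auto
      finally show "x $ i * ((A ^\<^sub>m k) $$ (i, j) * x $ j) \<le> (\<bar>x $ i\<bar> * \<bar>x $ j\<bar>) * (c * t ^ k)" .
    qed
    also have "\<dots> = (s * c) * t ^ k"
      unfolding s_def by (simp add: sum_distrib_right mult.assoc)
    finally show ?thesis .
  qed
  then show thesis using that by blast
qed

section \<open>Rayleigh quotients of real symmetric matrices\<close>

lemma scalar_prod_pow_symmetric:
  fixes A :: "'a :: comm_semiring_1 mat"
  assumes A: "A \<in> carrier_mat n n" and sym: "transpose_mat A = A"
    and x: "x \<in> carrier_vec n" and y: "y \<in> carrier_vec n"
  shows "(A ^\<^sub>m k *\<^sub>v y) \<bullet> (A ^\<^sub>m l *\<^sub>v x) = y \<bullet> (A ^\<^sub>m (l + k) *\<^sub>v x)"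
  using y
proof (induction k arbitrary: y l)
  case 0
  then show ?case using A x by simp
next
  case (Suc k)
  have Ak: "A ^\<^sub>m j \<in> carrier_mat n n" for j using A by simp
  have Ay: "A *\<^sub>v y \<in> carrier_vec n" using A Suc.prems by simp
  have Alx: "A ^\<^sub>m j *\<^sub>v x \<in> carrier_vec n" for j using Ak x by (rule mult_mat_vec_carrier)
  have comm: "A * A ^\<^sub>m j = A ^\<^sub>m Suc j" for j
  proof (induction j)
    case (Suc j)
    then show ?case using assoc_mult_mat[OF A Ak[of j] A] by simp
  qed (use A in simp)
  have "(A ^\<^sub>m Suc k *\<^sub>v y) \<bullet> (A ^\<^sub>m l *\<^sub>v x) = (A ^\<^sub>m k *\<^sub>v (A *\<^sub>v y)) \<bullet> (A ^\<^sub>m l *\<^sub>v x)"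
    using assoc_mult_mat_vec[OF Ak A Suc.prems] by simp
  also have "\<dots> = (A *\<^sub>v y) \<bullet> (A ^\<^sub>m (l + k) *\<^sub>v x)"
    using Suc.IH[OF Ay] .
  also have "\<dots> = y \<bullet> (A *\<^sub>v (A ^\<^sub>m (l + k) *\<^sub>v x))"
    using transpose_vec_mult_scalar[OF A Alx Suc.prems] by (simp add: sym)
  also have "A *\<^sub>v (A ^\<^sub>m (l + k) *\<^sub>v x) = A ^\<^sub>m (l + Suc k) *\<^sub>v x"
    using assoc_mult_mat_vec[OF A Ak x, of "l + k"] comm[of "l + k"] by simp
  finally show ?case .
qed

lemma scalar_prod_Cauchy_Schwarz:
  fixes x y :: "'a :: linordered_field vec"
  assumes "x \<in> carrier_vec n" "y \<in> carrier_vec n"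
  shows "(x \<bullet> y)\<^sup>2 \<le> (x \<bullet> x) * (y \<bullet> y)"
  using Cauchy_Schwarz_ineq_sum[of "\<lambda>i. x $ i" "\<lambda>i. y $ i" "{0..<n}"] assms
  by (simp add: scalar_prod_def power2_eq_square)

text \<open>
  Repeated squaring: each application of the Cauchy-Schwarz inequality to \<open>x\<close> and \<open>A^k x\<close> doubles
  the exponent \<open>k\<close>, symmetry turning \<open>(A^k x) \<bullet> (A^k x)\<close> into \<open>x \<bullet> A^(2k) x\<close>.
\<close>

lemma quadratic_form_pow_lower_bound:
  fixes A :: "real mat"
  assumes A: "A \<in> carrier_mat n n" and sym: "transpose_mat A = A"
    and x: "x \<in> carrier_vec n" and pos: "x \<bullet> x > 0" and q: "q \<ge> 0"
    and rayleigh: "q * (x \<bullet> x) \<le> x \<bullet> (A *\<^sub>v x)"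
  shows "(x \<bullet> x) * q ^ (2 ^ m) \<le> x \<bullet> (A ^\<^sub>m (2 ^ m) *\<^sub>v x)"
proof (induction m)
  case 0
  have "A ^\<^sub>m 1 = A" using A by simp
  then show ?case using rayleigh by (simp add: mult.commute)
next
  case (Suc m)
  let ?k = "2 ^ m :: nat"
  have Ax: "A ^\<^sub>m ?k *\<^sub>v x \<in> carrier_vec n"
    using pow_carrier_mat[OF A] x by (rule mult_mat_vec_carrier)
  have "(x \<bullet> x) * ((x \<bullet> x) * q ^ (2 ^ Suc m)) = ((x \<bullet> x) * q ^ ?k)\<^sup>2"
    by (simp add: power2_eq_square power_add mult_2)
  also have "\<dots> \<le> (x \<bullet> (A ^\<^sub>m ?k *\<^sub>v x))\<^sup>2"
    using Suc pos q by (intro power_mono) auto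
  also have "\<dots> \<le> (x \<bullet> x) * ((A ^\<^sub>m ?k *\<^sub>v x) \<bullet> (A ^\<^sub>m ?k *\<^sub>v x))"
    by (rule scalar_prod_Cauchy_Schwarz[OF x Ax])
  also have "(A ^\<^sub>m ?k *\<^sub>v x) \<bullet> (A ^\<^sub>m ?k *\<^sub>v x) = x \<bullet> (A ^\<^sub>m (2 ^ Suc m) *\<^sub>v x)"
    using scalar_prod_pow_symmetric[OF A sym x x, of ?k ?k] by (simp add: mult_2)
  finally show ?case using pos by simp
qed

text \<open>
  If \<open>q\<close> exceeded the spectral radius, then for any \<open>t\<close> strictly between the two, \<open>(q / t) ^ (2 ^ m)\<close>
  would be both bounded and unbounded in \<open>m\<close>.
\<close>

lemma rayleigh_le_spectral_radius:
  fixes A :: "real mat"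
  assumes A: "A \<in> carrier_mat n n" and sym: "transpose_mat A = A"
    and x: "x \<in> carrier_vec n" and pos: "x \<bullet> x > 0"
    and rayleigh: "q * (x \<bullet> x) \<le> x \<bullet> (A *\<^sub>v x)"
  shows "q \<le> spectral_radius (map_mat complex_of_real A)"
proof (rule ccontr)
  let ?\<rho> = "spectral_radius (map_mat complex_of_real A)"
  assume "\<not> q \<le> ?\<rho>"
  then obtain t where t: "?\<rho> < t" "t < q"
    using dense by (auto simp: not_le)
  have n: "n > 0" using pos x by (cases n) (auto simp: scalar_prod_def)
  have tpos: "t > 0"
    using t(1) spectral_radius_nonneg[of "map_mat complex_of_real A" n] A n by fastforce
  obtain c where c: "\<And>k. x \<bullet> (A ^\<^sub>m k *\<^sub>v x) \<le> c * t ^ k"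
    using quadratic_form_pow_bound[OF A n x t(1)] by blast
  have bounded: "(q / t) ^ (2 ^ m) \<le> c / (x \<bullet> x)" for m :: nat
  proof -
    have "(x \<bullet> x) * q ^ (2 ^ m) \<le> c * t ^ (2 ^ m)"
      using quadratic_form_pow_lower_bound[OF A sym x pos _ rayleigh, of m] c[of "2 ^ m"] t tpos
      by linarith
    then show ?thesis using tpos pos by (simp add: power_divide field_simps)
  qed
  have "1 < q / t" using t tpos by simp
  then obtain m where "c / (x \<bullet> x) < (q / t) ^ m"
    using real_arch_pow by blast
  also have "\<dots> \<le> (q / t) ^ (2 ^ m)"
    using t tpos by (intro power_increasing) (auto simp: less_imp_le)
  finally show False using bounded[of m] by simp
qed

section \<open>Vectors that are constant off one coordinate\<close>

lemma sum_two_valued: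
  fixes f :: "nat \<Rightarrow> 'a :: comm_ring"
  assumes "i < n"
  shows "(\<Sum>j<n. (if j = i then a else b) * f j) = a * f i + b * ((\<Sum>j<n. f j) - f i)"
proof -
  have "(\<Sum>j<n. (if j = i then a else b) * f j) = a * f i + (\<Sum>j\<in>{..<n} - {i}. b * f j)"
    using assms by (simp add: sum.remove[of _ i])
  also have "(\<Sum>j\<in>{..<n} - {i}. b * f j) = b * ((\<Sum>j<n. f j) - f i)"
    using assms by (simp add: sum.remove[of _ i] sum_distrib_left)
  finally show ?thesis .
qed

lemma quadratic_form_two_valued:
  fixes A :: "'a :: comm_ring_1 mat" and a b :: 'a
  assumes A: "A \<in> carrier_mat n n" and sym: "transpose_mat A = A"
    and diag: "A $$ (i, i) = 0" and i: "i < n"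
  defines "R \<equiv> \<Sum>j<n. A $$ (i, j)" and "S \<equiv> \<Sum>k<n. \<Sum>j<n. A $$ (k, j)"
    and "x \<equiv> vec n (\<lambda>j. if j = i then a else b)"
  shows "x \<bullet> (A *\<^sub>v x) = 2 * a * b * R + b\<^sup>2 * (S - 2 * R)"
proof -
  define row where "row k = (\<Sum>j<n. A $$ (k, j))" for k
  have col: "(\<Sum>k<n. A $$ (k, i)) = R"
  proof -
    have "A $$ (k, i) = A $$ (i, k)" if "k < n" for k
      using arg_cong[OF sym, of "\<lambda>M. M $$ (i, k)"] that i A by simp
    then show ?thesis unfolding R_def by (intro sum.cong) auto
  qed
  have "x \<bullet> (A *\<^sub>v x) =
      (\<Sum>k<n. (if k = i then a else b) * (\<Sum>j<n. (if j = i then a else b) * A $$ (k, j)))"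
    using A unfolding x_def by (simp add: scalar_prod_def atLeast0LessThan mult.commute)
  also have "\<dots> = (\<Sum>k<n. (if k = i then a else b) * (a * A $$ (k, i) + b * (row k - A $$ (k, i))))"
    by (simp only: sum_two_valued[OF i] row_def)
  also have "\<dots> = a * (b * R) + b * (a * R + b * (S - R) - b * R)"
    unfolding sum_two_valued[OF i]
    using diag by (simp add: sum.distrib sum_subtractf col row_def flip: sum_distrib_left R_def S_def)
  also have "\<dots> = 2 * a * b * R + b\<^sup>2 * (S - 2 * R)"
    by (simp add: algebra_simps power2_eq_square)
  finally show ?thesis .
qed

lemma norm_two_valued:
  fixes a b :: "'a :: comm_ring_1"
  assumes i: "i < n"
  defines "x \<equiv> vec n (\<lambda>j. if j = i then a else b)"
  shows "x \<bullet> x = a\<^sup>2 + (of_nat n - 1) * b\<^sup>2"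
proof -
  have "x \<bullet> x = (\<Sum>j<n. (if j = i then a else b) * (if j = i then a else b))"
    unfolding x_def by (simp add: scalar_prod_def atLeast0LessThan)
  also have "\<dots> = a * a + b * (\<Sum>j<n. (if j = i then a else b) * 1) - b * a"
    unfolding sum_two_valued[OF i, of a b "\<lambda>j. if j = i then a else b"] by (simp add: algebra_simps)
  also have "\<dots> = a\<^sup>2 + (of_nat n - 1) * b\<^sup>2"
    unfolding sum_two_valued[OF i] by (simp add: algebra_simps power2_eq_square)
  finally show ?thesis .
qed

text \<open>
  The \<open>2 \<times> 2\<close> matrix of block averages for the partition into \<open>{i}\<close> and its complement has the
  larger eigenvalue \<open>\<lambda>\<close>. If \<open>\<lambda> \<noteq> 0\<close>, then \<open>(R, \<lambda>)\<close> is an eigenvector, and the corresponding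
  two-valued vector has Rayleigh quotient exactly \<open>\<lambda>\<close>. If \<open>\<lambda> = 0\<close>, this vector vanishes, but
  the bound is trivial.
\<close>

lemma spectral_radius_ge_larger_root:
  fixes A :: "real mat"
  assumes A: "A \<in> carrier_mat n n" and sym: "transpose_mat A = A"
    and diag: "A $$ (i, i) = 0" and i: "i < n" and n: "n > 1"
  defines "R \<equiv> \<Sum>j<n. A $$ (i, j)" and "S \<equiv> \<Sum>k<n. \<Sum>j<n. A $$ (k, j)"
  defines "M \<equiv> S / 2 - R"
  shows "1 / (real n - 1) * (M + sqrt (M\<^sup>2 + (real n - 1) * R\<^sup>2))
    \<le> spectral_radius (map_mat complex_of_real A)"
proof -
  define d where "d = real n - 1"
  have d: "d > 0" using n by (simp add: d_def)
  define l where "l = 1 / d * (M + sqrt (M\<^sup>2 + d * R\<^sup>2))"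
  \<comment> \<open>\<open>l\<close> is a root of the characteristic equation of the matrix of block averages.\<close>
  have root: "d * l\<^sup>2 = 2 * M * l + R\<^sup>2"
  proof -
    have "(d * l - M)\<^sup>2 = M\<^sup>2 + d * R\<^sup>2"
      using d by (simp add: l_def)
    then have "d * (d * l\<^sup>2) = d * (2 * M * l + R\<^sup>2)"
      by (simp add: power2_eq_square algebra_simps)
    then show ?thesis using d by simp
  qed
  have "l \<le> spectral_radius (map_mat complex_of_real A)"
  proof (cases "l = 0")
    case True
    then show ?thesis
      using spectral_radius_nonneg[of "map_mat complex_of_real A" n] A n by simp
  next
    case False
    define x where "x = vec n (\<lambda>j. if j = i then R else l)"
    have norm: "x \<bullet> x = R\<^sup>2 + d * l\<^sup>2"
      unfolding x_def d_def by (rule norm_two_valued[OF i, of R l])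
    have form: "x \<bullet> (A *\<^sub>v x) = 2 * R * l * R + l\<^sup>2 * (2 * M)"
      using quadratic_form_two_valued[OF A sym diag i, of R l]
      unfolding x_def R_def S_def M_def by (simp add: algebra_simps)
    have "l * (x \<bullet> x) = x \<bullet> (A *\<^sub>v x)"
      unfolding norm form root by (simp add: power2_eq_square algebra_simps)
    moreover have "x \<bullet> x > 0"
      unfolding norm using d False by (intro add_nonneg_pos) auto
    moreover have "x \<in> carrier_vec n" by (simp add: x_def)
    ultimately show ?thesis
      using rayleigh_le_spectral_radius[OF A sym] by simp
  qed
  then show ?thesis by (simp add: l_def d_def)
qed

section \<open>The level matrix\<close>

theorem theorem7:
  fixes T :: "'a pair_pre_digraph" and r :: 'a and vs :: "'a list" and n :: nat
  assumes "rooted_tree T r"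
    and "distinct vs" and "set vs = pverts T"
    and "n = card (pverts T)" and "n > 1"
  shows "level_spectral_radius T r vs \<ge>
    1 / (real n - 1) *
      (MAX i\<in>{..<n}.
         level_index T r vs - level_row_sum T r vs i
         + sqrt ((level_index T r vs - level_row_sum T r vs i)\<^sup>2
                 + (real n - 1) * (level_row_sum T r vs i)\<^sup>2))"
proof -
  let ?f = "\<lambda>i. level_index T r vs - level_row_sum T r vs i
         + sqrt ((level_index T r vs - level_row_sum T r vs i)\<^sup>2
                 + (real n - 1) * (level_row_sum T r vs i)\<^sup>2)"
  let ?L = "level_matrix T r vs"
  have len: "length vs = n"
    using assms(2-4) distinct_card by fastforce
  have L: "?L \<in> carrier_mat n n" by (simp add: level_matrix_def len)
  have sym: "transpose_mat ?L = ?L"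
    by (rule eq_matI) (auto simp: level_matrix_def)
  have "Max (?f ` {..<n}) \<in> ?f ` {..<n}"
    using \<open>n > 1\<close> by (intro Max_in) auto
  then obtain i where i: "i < n" and max: "Max (?f ` {..<n}) = ?f i"
    by auto
  have "?L $$ (i, i) = 0" using i by (simp add: level_matrix_def len)
  from spectral_radius_ge_larger_root[OF L sym this i \<open>n > 1\<close>] show ?thesis
    unfolding max by (simp add: level_spectral_radius_def level_index_def level_row_sum_def len)
qed

end
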